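(* Let an HH continued fraction with coefficients $(\alpha_i,\beta_i)_{i\in\mathbb Z}$ be given, and let $n$ be an integer and $r$ a positive integer. (A) If the HH continued fraction is periodic with period $2r$ and even symmetric with $\alpha_n$ as the centre, then it is also even symmetric with respect to $\alpha_{n+r}$. (B) If it is periodic with period $2r$ and odd symmetric with respect to $\beta_n$, then it is also odd symmetric with respect to $\beta_{n+r}$. (C) If it is periodic with period $2r-1$ and even symmetric with respect to $\alpha_n$, then it is also odd symmetric with respect to $\beta_{n+r}$. Conversely, if it is periodic with period $2r-1$ and odd symmetric with respect to $\beta_{n+r}$, then it is even symmetric with respect to $\alpha_n$.
   Context: Work over $\mathbb C$. Let $g\ge 1$, let $X$ be a polynomial in $x$ of degree $2g+2$ that is not the square of a polynomial, and let $\epsilon\in\mathbb C$ with $X(\epsilon)\ne 0$. Put $s=x-\epsilon$ and $S(s)=X(\epsilon+s)$. Fix a square root of $X(\epsilon)$ and let $\sqrt X$ be the analytic branch near $s=0$ with this value at $s=0$. A (regular) two-sided HH (hyperelliptic Halphen) development is a sequence $(t_i,A^{(i)})_{i\in\mathbb Z}$, with $t_i\in\mathbb C\setminus\{0\}$ and $A^{(i)}\in\mathbb C[s]$ of degree at most $g+1$, such that for every $i$: $A^{(i)}\equiv\sqrt X \pmod{s^{g+1}}$; $S-(A^{(i)})^2=s^{g+1}(s-t_i)B^{(i)}$ with $B^{(i)}$ a polynomial of degree exactly $g$ with no root equal to $0$; $B^{(i)}(t_{i+1})=0$; and $A^{(i)}(t_{i+1})=-A^{(i+1)}(t_{i+1})$.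 The coefficients of the associated HH continued fraction are, for $i\in\mathbb Z$, $$\alpha_i=\frac{A^{(i-1)}(s)-A^{(i-1)}(t_i)}{s-t_i}+\frac{A^{(i)}(s)-A^{(i)}(t_i)}{s-t_i},\qquad \beta_i=\frac{s^{g+1}B^{(i-1)}(s)}{s-t_i}.$$ The HH continued fraction is: - periodic with period $p$ ($p\geq1$) if $\alpha_r=\alpha_s$ and $\beta_r=\beta_s$ whenever $r\equiv s\pmod p$ ($p$ need not be minimal); - even symmetric with respect to (with centre) $\alpha_n$ if $\alpha_{n-i}=\alpha_{n+i}$ and $\beta_{n-i}=\beta_{n+i+1}$ for all $i\in\mathbb Z$; - odd symmetric with respect to (with centre) $\beta_n$ if $\alpha_{n-i}=\alpha_{n+i-1}$ and $\beta_{n-i}=\beta_{n+i}$ for all $i\in\mathbb Z$. *)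

theory Defs
  imports
    "HOL-Complex_Analysis.Complex_Analysis"
    "HOL-Number_Theory.Cong"
begin

definition shifted_poly :: "complex poly \<Rightarrow> complex \<Rightarrow> complex poly" where
  "shifted_poly X \<epsilon> = pcompose X [:\<epsilon>, 1:]"

lemma poly_shifted_poly: "poly (shifted_poly X \<epsilon>) s = poly X (\<epsilon> + s)"
  by (simp add: shifted_poly_def poly_pcompose)

text \<open>The analytic branch near \<open>s = 0\<close> of the square root of \<open>S\<close> with value \<open>w\<close> at \<open>0\<close>;
  for \<open>w \<noteq> 0\<close> its germ at \<open>0\<close> is unique.\<close>

definition sqrt_branch :: "complex poly \<Rightarrow> complex \<Rightarrow> (complex \<Rightarrow> complex) \<Rightarrow> bool" where
  "sqrt_branch S w f \<longleftrightarrow>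
     f analytic_on {0} \<and> f 0 = w \<and> (\<forall>\<^sub>F s in nhds 0. (f s)\<^sup>2 = poly S s)"

text \<open>Congruence modulo \<open>s ^ m\<close> is divisibility of the difference of the Taylor series at \<open>0\<close>.\<close>

definition cong_branch :: "complex poly \<Rightarrow> (complex \<Rightarrow> complex) \<Rightarrow> nat \<Rightarrow> bool" where
  "cong_branch P f m \<longleftrightarrow> fps_X ^ m dvd fps_of_poly P - fps_expansion f 0"

text \<open>All polynomials below are in the variable \<open>s\<close>. In an HH development (and hence also in
  \<open>HH_alpha\<close> and \<open>HH_beta\<close>) every polynomial division is exact; in particular \<open>B\<close> is
  determined by \<open>t\<close> and \<open>A\<close> (lemmas below).\<close>

definition HH_B ::
  "nat \<Rightarrow> complex poly \<Rightarrow> (int \<Rightarrow> complex) \<Rightarrow> (int \<Rightarrow> complex poly) \<Rightarrow> int \<Rightarrow> complex poly" where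
  "HH_B g S t A i = (S - (A i)\<^sup>2) div (monom 1 (g + 1) * [:- t i, 1:])"

definition HH_development ::
  "nat \<Rightarrow> complex poly \<Rightarrow> (complex \<Rightarrow> complex) \<Rightarrow> (int \<Rightarrow> complex) \<Rightarrow> (int \<Rightarrow> complex poly) \<Rightarrow> bool" where
  "HH_development g S f t A \<longleftrightarrow> (\<forall>i.
     t i \<noteq> 0 \<and>
     degree (A i) \<le> g + 1 \<and>
     cong_branch (A i) f (g + 1) \<and>
     S - (A i)\<^sup>2 = monom 1 (g + 1) * [:- t i, 1:] * HH_B g S t A i \<and>
     degree (HH_B g S t A i) = g \<and>
     poly (HH_B g S t A i) 0 \<noteq> 0 \<and>
     poly (HH_B g S t A i) (t (i + 1)) = 0 \<and>
     poly (A i) (t (i + 1)) = - poly (A (i + 1)) (t (i + 1)))"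

definition HH_alpha :: "(int \<Rightarrow> complex) \<Rightarrow> (int \<Rightarrow> complex poly) \<Rightarrow> int \<Rightarrow> complex poly" where
  "HH_alpha t A i =
     (A (i - 1) - [:poly (A (i - 1)) (t i):]) div [:- t i, 1:] +
     (A i - [:poly (A i) (t i):]) div [:- t i, 1:]"

definition HH_beta ::
  "nat \<Rightarrow> complex poly \<Rightarrow> (int \<Rightarrow> complex) \<Rightarrow> (int \<Rightarrow> complex poly) \<Rightarrow> int \<Rightarrow> complex poly" where
  "HH_beta g S t A i = (monom 1 (g + 1) * HH_B g S t A (i - 1)) div [:- t i, 1:]"

lemma HH_B_unique:
  assumes "S - (A i)\<^sup>2 = monom 1 (g + 1) * [:- t i, 1:] * B"
  shows "HH_B g S t A i = B"
  unfolding HH_B_def assms by (rule nonzero_mult_div_cancel_left) (simp add: monom_eq_0_iff del: mult_pCons_right mult_pCons_left)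

lemma HH_alpha_exact:
  "[:- t i, 1:] * HH_alpha t A i =
     (A (i - 1) - [:poly (A (i - 1)) (t i):]) + (A i - [:poly (A i) (t i):])"
proof -
  have "[:- t i, 1:] dvd P - [:poly P (t i):]" for P :: "complex poly"
    by (simp add: poly_eq_0_iff_dvd[symmetric])
  then show ?thesis
    unfolding HH_alpha_def by (simp only: distrib_left dvd_mult_div_cancel)
qed

lemma HH_beta_exact:
  assumes "HH_development g S f t A"
  shows "[:- t i, 1:] * HH_beta g S t A i = monom 1 (g + 1) * HH_B g S t A (i - 1)"
proof -
  have "poly (HH_B g S t A (i - 1)) (t (i - 1 + 1)) = 0"
    using assms unfolding HH_development_def by blast
  then have "[:- t i, 1:] dvd monom 1 (g + 1) * HH_B g S t A (i - 1)"
    by (simp add: poly_eq_0_iff_dvd[symmetric])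
  then show ?thesis
    unfolding HH_beta_def by (rule dvd_mult_div_cancel)
qed

definition cf_periodic ::
  "(int \<Rightarrow> complex poly) \<Rightarrow> (int \<Rightarrow> complex poly) \<Rightarrow> int \<Rightarrow> bool" where
  "cf_periodic \<alpha> \<beta> p \<longleftrightarrow>
     p \<ge> 1 \<and> (\<forall>k l. [k = l] (mod p) \<longrightarrow> \<alpha> k = \<alpha> l \<and> \<beta> k = \<beta> l)"

definition cf_even_symmetric ::
  "(int \<Rightarrow> complex poly) \<Rightarrow> (int \<Rightarrow> complex poly) \<Rightarrow> int \<Rightarrow> bool" where
  "cf_even_symmetric \<alpha> \<beta> n \<longleftrightarrow>
     (\<forall>i. \<alpha> (n - i) = \<alpha> (n + i) \<and> \<beta> (n - i) = \<beta> (n + i + 1))"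

definition cf_odd_symmetric ::
  "(int \<Rightarrow> complex poly) \<Rightarrow> (int \<Rightarrow> complex poly) \<Rightarrow> int \<Rightarrow> bool" where
  "cf_odd_symmetric \<alpha> \<beta> n \<longleftrightarrow>
     (\<forall>i. \<alpha> (n - i) = \<alpha> (n + i - 1) \<and> \<beta> (n - i) = \<beta> (n + i))"

end

theory Submission
  imports Defs
begin

text \<open>Each symmetry says that the two coefficient sequences are invariant under reflections
  \<open>k -> c - k\<close> of the index. The constants \<open>c\<close> for (\<alpha>, \<beta>) are
  (2n, 2n + 1) for even symmetry about \<alpha>_n and (2n - 1, 2n) for odd symmetry about \<beta>_n.
  A period \<open>p\<close> allows \<open>p\<close> to be added to both constants. Adding 2r turns n
  into n + r within the same type; adding 2r - 1 turns (2n, 2n + 1) into (2(n + r) - 1, 2(n + r)),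
  the odd constants at n + r.\<close>

lemma cf_even_symmetric_iff:
  "cf_even_symmetric \<alpha> \<beta> n \<longleftrightarrow>
     (\<forall>k. \<alpha> k = \<alpha> (2 * n - k) \<and> \<beta> k = \<beta> (2 * n + 1 - k))"
  (is "?L \<longleftrightarrow> ?R")
proof
  assume L: ?L
  show ?R
  proof
    fix k
    show "\<alpha> k = \<alpha> (2 * n - k) \<and> \<beta> k = \<beta> (2 * n + 1 - k)"
      \<comment> \<open>The substitution i = n - k is an involution, so it also serves for the
        converse.\<close>
      using L[unfolded cf_even_symmetric_def, rule_format, of "n - k"]
      by (simp add: algebra_simps)
  qed
next
  assume R: ?R
  show ?L
    unfolding cf_even_symmetric_def
  proof
    fix i
    show "\<alpha> (n - i) = \<alpha> (n + i) \<and> \<beta> (n - i) = \<beta> (n + i + 1)"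
      using R[rule_format, of "n - i"] by (simp add: algebra_simps)
  qed
qed

lemma cf_odd_symmetric_iff:
  "cf_odd_symmetric \<alpha> \<beta> n \<longleftrightarrow>
     (\<forall>k. \<alpha> k = \<alpha> (2 * n - 1 - k) \<and> \<beta> k = \<beta> (2 * n - k))"
  (is "?L \<longleftrightarrow> ?R")
proof
  assume L: ?L
  show ?R
  proof
    fix k
    show "\<alpha> k = \<alpha> (2 * n - 1 - k) \<and> \<beta> k = \<beta> (2 * n - k)"
      using L[unfolded cf_odd_symmetric_def, rule_format, of "n - k"]
      by (simp add: algebra_simps)
  qed
next
  assume R: ?R
  show ?L
    unfolding cf_odd_symmetric_def
  proof
    fix i
    show "\<alpha> (n - i) = \<alpha> (n + i - 1) \<and> \<beta> (n - i) = \<beta> (n + i)"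
      using R[rule_format, of "n - i"] by (simp add: algebra_simps)
  qed
qed

text \<open>The shifted index is a variable with its own equation, so that the rule matches index
  expressions of any shape and leaves only linear arithmetic.\<close>

lemma cf_periodic_shift:
  assumes "cf_periodic \<alpha> \<beta> p" and "l = k + p"
  shows "\<alpha> l = \<alpha> k" and "\<beta> l = \<beta> k"
proof -
  have "[l = k] (mod p)"
    using assms(2) by (simp add: cong_def)
  then show "\<alpha> l = \<alpha> k" and "\<beta> l = \<beta> k"
    using assms(1) unfolding cf_periodic_def by blast+
qed

theorem proposition7:
  fixes g :: nat and X S :: "complex poly" and \<epsilon> w :: complex
    and f :: "complex \<Rightarrow> complex"
    and t :: "int \<Rightarrow> complex" and A \<alpha> \<beta> :: "int \<Rightarrow> complex poly"
    and n r :: int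
  assumes "g \<ge> 1"
    and "degree X = 2 * g + 2"
    and "\<not> (\<exists>Y. X = Y\<^sup>2)"
    and "poly X \<epsilon> \<noteq> 0"
    and "S = shifted_poly X \<epsilon>"
    and "w\<^sup>2 = poly X \<epsilon>"
    and "sqrt_branch S w f"
    and "HH_development g S f t A"
    and "\<alpha> = HH_alpha t A"
    and "\<beta> = HH_beta g S t A"
    and "r > 0"
  shows "(cf_periodic \<alpha> \<beta> (2 * r) \<and> cf_even_symmetric \<alpha> \<beta> n
            \<longrightarrow> cf_even_symmetric \<alpha> \<beta> (n + r))
       \<and> (cf_periodic \<alpha> \<beta> (2 * r) \<and> cf_odd_symmetric \<alpha> \<beta> n
            \<longrightarrow> cf_odd_symmetric \<alpha> \<beta> (n + r))
       \<and> (cf_periodic \<alpha> \<beta> (2 * r - 1) \<and> cf_even_symmetric \<alpha> \<beta> n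
            \<longrightarrow> cf_odd_symmetric \<alpha> \<beta> (n + r))
       \<and> (cf_periodic \<alpha> \<beta> (2 * r - 1) \<and> cf_odd_symmetric \<alpha> \<beta> (n + r)
            \<longrightarrow> cf_even_symmetric \<alpha> \<beta> n)"
proof (intro conjI impI; elim conjE)
  assume p: "cf_periodic \<alpha> \<beta> (2 * r)"
  \<comment> \<open>Moving the centre by r changes each reflection constant by 2r, exactly one
    period.\<close>
  have shift: "\<alpha> (2 * (n + r) - k) = \<alpha> (2 * n - k)"
    "\<beta> (2 * (n + r) + 1 - k) = \<beta> (2 * n + 1 - k)" for k
    by (rule cf_periodic_shift[OF p]; simp)+
  assume "cf_even_symmetric \<alpha> \<beta> n"
  then show "cf_even_symmetric \<alpha> \<beta> (n + r)"
    unfolding cf_even_symmetric_iff shift .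
next
  assume p: "cf_periodic \<alpha> \<beta> (2 * r)"
  have shift: "\<alpha> (2 * (n + r) - 1 - k) = \<alpha> (2 * n - 1 - k)"
    "\<beta> (2 * (n + r) - k) = \<beta> (2 * n - k)" for k
    by (rule cf_periodic_shift[OF p]; simp)+
  assume "cf_odd_symmetric \<alpha> \<beta> n"
  then show "cf_odd_symmetric \<alpha> \<beta> (n + r)"
    unfolding cf_odd_symmetric_iff shift .
next
  assume p: "cf_periodic \<alpha> \<beta> (2 * r - 1)"
  \<comment> \<open>The odd constants at n + r exceed the even constants at n by 2r - 1, for
    \<alpha> and \<beta> alike.\<close>
  have shift: "\<alpha> (2 * (n + r) - 1 - k) = \<alpha> (2 * n - k)"
    "\<beta> (2 * (n + r) - k) = \<beta> (2 * n + 1 - k)" for k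
    by (rule cf_periodic_shift[OF p]; simp)+
  \<comment> \<open>After rewriting by \<open>shift\<close> both sides are the same formula, so the
    two implications for odd period follow together.\<close>
  have iff: "cf_odd_symmetric \<alpha> \<beta> (n + r) \<longleftrightarrow> cf_even_symmetric \<alpha> \<beta> n"
    unfolding cf_even_symmetric_iff cf_odd_symmetric_iff shift ..
  show "cf_odd_symmetric \<alpha> \<beta> (n + r)" if "cf_even_symmetric \<alpha> \<beta> n"
    using that iff by blast
  show "cf_even_symmetric \<alpha> \<beta> n" if "cf_odd_symmetric \<alpha> \<beta> (n + r)"
    using that iff by blast
qed

end
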